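(* Let $n,m\in\mathbb{N}$, $S\subseteq\mathbb{Z}^n$, $x(0)\in S$, and let $\mathcal{U}\subseteq\mathbb{Z}^n$ be finite. Let $G=(V,E)$ be the directed graph with $V=\mathbb{Z}^n$ and $E=\{(x,y)\mid y-x\in\mathcal{U}\}$. If there exist an induced subgraph $G_{\hat{S}}=(\hat{S},E_{\hat{S}})\subseteq G$ with $\hat{S}\subseteq S$ and a labeling $l:E_{\hat{S}}\to[m]$ satisfying (C1) $x(0)\in\hat{S}$; (C2) for all $x\in\hat{S}$, $l\left(\{(x,x')\in E_{\hat{S}}\mid x'\in\hat{S}\}\right)=[m]$; (C3) if $(x,y),(x',y')\in E_{\hat{S}}$ satisfy $y-x=y'-x'$, then $l(x,y)=l(x',y')$; then $$\operatorname{mindeg}(G_{\hat{S}})\geq m.$$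
   Context: Notation: $\mathbb{N}$ is the set of strictly positive integers, $[m]=\{1,\ldots,m\}$. The induced subgraph $G_{\hat{S}}$ has vertex set $\hat{S}$ and edge set $E_{\hat{S}}=\{(x,y)\in E\mid x,y\in\hat{S}\}$ (loops are included if $0\in\mathcal{U}$). For a set $A$ of edges, $l(A)$ is the image of $A$ under $l$. $\operatorname{mindeg}(G_{\hat{S}})$ is the minimal outgoing degree in $G_{\hat{S}}$ of any vertex in $\hat{S}$. *)

theory Defs
  imports "HOL-Analysis.Finite_Cartesian_Product" "Graph_Theory.Pair_Digraph"
    "Graph_Theory.Digraph_Component"
begin

definition lattice_digraph :: "(int ^ 'n) set \<Rightarrow> (int ^ 'n, (int ^ 'n) \<times> (int ^ 'n)) pre_digraph"
  where "lattice_digraph U = with_proj \<lparr>pverts = UNIV, parcs = {(x, y). y - x \<in> U}\<rparr>"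

(* The vertex set may be infinite, so Min is not available; on a nonempty vertex set the infimum
   of the natural numbers below is attained (see min_out_degree_attained). *)
definition min_out_degree :: "('a, 'b) pre_digraph \<Rightarrow> nat"
  where "min_out_degree G = (INF v\<in>verts G. out_degree G v)"

lemma min_out_degree_attained:
  assumes "verts G \<noteq> {}"
  shows "\<exists>v\<in>verts G. out_degree G v = min_out_degree G"
proof -
  have "Inf (out_degree G ` verts G) \<in> out_degree G ` verts G"
    using assms by (intro Inf_nat_def1) simp
  then show ?thesis
    by (auto simp: min_out_degree_def)
qed

end

theory Submission
  imports Defs
begin

text \<open>At each vertex of \<open>Shat\<close>, (C2) makes \<open>l\<close> a surjection from the
  outgoing arcs that stay in \<open>Shat\<close> onto \<open>{1..m}\<close>. A vertex has at most
  one outgoing arc per element of the finite set \<open>U\<close>, so the arcs can be counted and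
  number at least \<open>m\<close>. A bound valid at every vertex holds for the minimum, which is
  the degree of an actual vertex.\<close>

lemma finite_out_arcs_lattice_digraph:
  fixes U :: "(int ^ 'n) set"
  assumes "finite U"
  shows "finite (out_arcs (lattice_digraph U) v)"
proof (rule finite_subset)
  \<comment> \<open>An arc from \<open>v\<close> is determined by its displacement, head minus
    \<open>v\<close>, which lies in \<open>U\<close>.\<close>
  show "out_arcs (lattice_digraph U) v \<subseteq> (\<lambda>u. (v, v + u)) ` U"
    by (auto simp: lattice_digraph_def intro!: image_eqI[where x = "_ - v"])
qed (use assms in simp)

theorem proposition2:
  fixes m :: nat
    and S :: "(int ^ 'n) set"
    and x0 :: "int ^ 'n"
    and U :: "(int ^ 'n) set"
    and Shat :: "(int ^ 'n) set"
    and l :: "(int ^ 'n) \<times> (int ^ 'n) \<Rightarrow> nat"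
  defines "G \<equiv> lattice_digraph U"
  assumes m: "m \<ge> 1"
    and x0_S: "x0 \<in> S"
    and fin_U: "finite U"
    and Shat_S: "Shat \<subseteq> S"
    and labeling: "l \<in> arcs (G \<restriction> Shat) \<rightarrow> {1..m}"
    and C1: "x0 \<in> Shat"
    and C2: "\<And>x. x \<in> Shat \<Longrightarrow> l ` {(x, x') | x'. (x, x') \<in> arcs (G \<restriction> Shat) \<and> x' \<in> Shat} = {1..m}"
    and C3: "\<And>x y x' y'. (x, y) \<in> arcs (G \<restriction> Shat) \<Longrightarrow> (x', y') \<in> arcs (G \<restriction> Shat) \<Longrightarrow>
               y - x = y' - x' \<Longrightarrow> l (x, y) = l (x', y')"
  shows "min_out_degree (G \<restriction> Shat) \<ge> m"
proof -
  have "m \<le> out_degree (G \<restriction> Shat) v" if v: "v \<in> Shat" for v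
  proof -
    let ?A = "out_arcs (G \<restriction> Shat) v"
    \<comment> \<open>Finiteness is essential: \<open>out_degree\<close> is a \<open>card\<close>,
      which would be 0 on an infinite set of arcs.\<close>
    have "finite ?A"
      by (rule finite_subset[OF _ finite_out_arcs_lattice_digraph[OF fin_U, of v]])
        (auto simp: G_def)
    \<comment> \<open>Arcs are pairs whose tail is the first component, so the arcs in (C2) leave
      \<open>v\<close>.\<close>
    have "{(v, x') | x'. (v, x') \<in> arcs (G \<restriction> Shat) \<and> x' \<in> Shat} \<subseteq> ?A"
      by (auto simp: G_def lattice_digraph_def)
    then have "{1..m} \<subseteq> l ` ?A"
      using C2[OF v] by blast
    then have "card {1..m} \<le> card ?A"
      using \<open>finite ?A\<close> by (rule surj_card_le[rotated])
    then show ?thesis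
      by (simp add: out_degree_def)
  qed
  \<comment> \<open>By (C1), \<open>x0\<close> is a vertex, so the infimum is over a nonempty set
    and is attained.\<close>
  moreover obtain v where "v \<in> verts (G \<restriction> Shat)"
    "out_degree (G \<restriction> Shat) v = min_out_degree (G \<restriction> Shat)"
    using min_out_degree_attained[of "G \<restriction> Shat"] C1 by auto
  ultimately show ?thesis
    by (metis induce_subgraph_verts)
qed

end
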